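(* Suppose that $S:\mathbb{R}^n\to\mathbb{R}^n$ is nonexpansive, that $\mathrm{fix}\,S=\emptyset$, that $\inf_{x\in\mathbb{R}^n}\|Sx-x\|_2=c>0$, and that $\bar\alpha\in(0,1)$. Then for every sequence generated by the line search iteration (with nominal step length $\bar\alpha$) there exists $d\in\mathbb{R}^n$ with $\|d\|_2=c$ such that $r^k\to d$ and $x^{k+1}-x^k\to\bar\alpha d$ as $k\to\infty$.
   Context: $\|\cdot\|_2$ is the Euclidean norm on $\mathbb{R}^n$. $S$ is nonexpansive if $\|Su-Sv\|_2\le\|u-v\|_2$ for all $u,v\in\mathbb{R}^n$. $\mathrm{fix}\,S=\{x\in\mathbb{R}^n : x=Sx\}$ is the set of fixed points of $S$. Line search iteration: fix algorithm parameters $\bar\alpha\in(0,1)$ (nominal step length), $\epsilon\in(0,1)$ and $\alpha^{\max}\ge\bar\alpha$, and an arbitrary starting point $x^0\in\mathbb{R}^n$. For $k=0,1,2,\dots$ set $$r^k:=Sx^k-x^k,\qquad \bar x^k:=x^k+\bar\alpha r^k,\qquad \bar r^k:=S\bar x^k-\bar x^k,\qquad x^{k+1}:=x^k+\alpha_k r^k,$$ where for each $k$ the step length $\alpha_k$ satisfies: either $\alpha_k=\bar\alpha$, or $\alpha_k\in(\bar\alpha,\alpha^{\max}]$ is such that the line search test $\|r^{k+1}\|_2=\|Sx^{k+1}-x^{k+1}\|_2\le(1-\epsilon)\|\bar r^k\|_2$ holds. The choice of $\alpha_k$ is otherwise arbitrary. *)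

theory Defs
  imports "HOL-Analysis.Analysis"
begin

definition nonexpansive :: "(real ^ 'n \<Rightarrow> real ^ 'n) \<Rightarrow> bool" where
  "nonexpansive S \<longleftrightarrow> (\<forall>u v. norm (S u - S v) \<le> norm (u - v))"

definition fixed_points :: "(real ^ 'n \<Rightarrow> real ^ 'n) \<Rightarrow> (real ^ 'n) set" where
  "fixed_points S = {x. x = S x}"

definition residual :: "(real ^ 'n \<Rightarrow> real ^ 'n) \<Rightarrow> real ^ 'n \<Rightarrow> real ^ 'n" where
  "residual S x = S x - x"

text \<open>
  The iteration is nondeterministic, so it is a predicate on the pair of the iterates \<open>x\<close> and
  the step lengths \<open>\<alpha>\<close>. The starting point \<open>x 0\<close> is unconstrained.
\<close>

definition line_search_iteration ::
  "(real ^ 'n \<Rightarrow> real ^ 'n) \<Rightarrow> real \<Rightarrow> real \<Rightarrow> real \<Rightarrow> (nat \<Rightarrow> real ^ 'n) \<Rightarrow> (nat \<Rightarrow> real) \<Rightarrow> bool" where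
  "line_search_iteration S \<alpha>bar \<epsilon> \<alpha>max x \<alpha> \<longleftrightarrow>
    (\<forall>k. let r = residual S (x k); xbar = x k + \<alpha>bar *\<^sub>R r; rbar = residual S xbar in
      x (Suc k) = x k + \<alpha> k *\<^sub>R r \<and>
      (\<alpha> k = \<alpha>bar \<or>
       \<alpha> k \<in> {\<alpha>bar<..\<alpha>max} \<and> norm (residual S (x (Suc k))) \<le> (1 - \<epsilon>) * norm rbar))"

end

theory Submission imports Defs begin

text \<open>
  The residual norm never increases along the iteration, because an averaged step
  cannot increase it, and an accepted line search step shrinks it by the factor
  \<open>1 - \<epsilon>\<close>. Since the norm never falls below \<open>c > 0\<close>, only finitely many line search steps
  are accepted, and a tail of the sequence is an orbit of the averaged map
  \<open>z \<mapsto> z + \<alpha>bar *\<^sub>R (S z - z)\<close>. Two facts settle the behaviour of such an orbit.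

  The first is that the residuals along two orbits of the averaged map become asymptotically equal:
  the squared distance of the two orbits drops in each step by a fixed multiple of the squared
  difference of the residuals. Comparison with an orbit started at an almost minimal
  residual shows that the residual norms tend to \<open>c\<close> (\<open>averaged_orbit_residual_norm_tendsto\<close>).

  The second is that the residuals lie in a half-space touching the sphere of radius \<open>c\<close>: there is
  a vector \<open>d\<close> of norm \<open>c\<close> such that \<open>inner (residual S z) d \<ge> c\<^sup>2\<close> for all \<open>z\<close>
  (\<open>residual_half_space\<close>). It is a cluster point of the residuals at the fixed points of the
  contractions \<open>z \<mapsto> S z /\<^sub>R (1 + t)\<close> as \<open>t\<close> tends to 0, and the inequality comes from the
  monotonicity of \<open>z \<mapsto> z - S z\<close>. The half-space bound gives
  \<open>\<parallel>r - d\<parallel>\<^sup>2 \<le> \<parallel>r\<parallel>\<^sup>2 - c\<^sup>2\<close> for every residual \<open>r\<close>, so that convergence of the norms to \<open>c\<close>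
  forces convergence of the residuals to \<open>d\<close>.
\<close>

section \<open>A supporting half-space of the set of residuals\<close>

lemma inner_residual_diff_nonpos:
  fixes S :: "real ^ 'n \<Rightarrow> real ^ 'n"
  assumes "nonexpansive S"
  shows "inner (residual S u - residual S v) (u - v) \<le> 0"
proof -
  have "inner (S u - S v) (u - v) \<le> norm (S u - S v) * norm (u - v)"
    by (rule norm_cauchy_schwarz)
  also have "\<dots> \<le> norm (u - v) * norm (u - v)"
    using assms by (intro mult_right_mono) (auto simp: nonexpansive_def)
  also have "\<dots> = inner (u - v) (u - v)"
    by (simp add: norm_eq_sqrt_inner)
  finally show ?thesis
    by (simp add: residual_def algebra_simps)
qed

text \<open>
  These points regularise the (possibly unsolvable) equation \<open>S z = z\<close>: dividing \<open>S\<close> by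
  \<open>1 + t\<close> makes it a contraction, whose fixed point exists by Banach's theorem.
\<close>

lemma exists_residual_eq_scaleR:
  fixes S :: "real ^ 'n \<Rightarrow> real ^ 'n"
  assumes S: "nonexpansive S" and t: "t > 0"
  shows "\<exists>z. residual S z = t *\<^sub>R z \<and> norm (residual S z) \<le> norm (S 0)"
proof -
  have "\<exists>!z\<in>UNIV. S z /\<^sub>R (1 + t) = z"
  proof (rule Banach_fix[where c = "1 / (1 + t)"])
    fix u v
    have "norm (S u - S v) \<le> norm (u - v)"
      using S by (simp add: nonexpansive_def)
    then show "dist (S u /\<^sub>R (1 + t)) (S v /\<^sub>R (1 + t)) \<le> 1 / (1 + t) * dist u v"
      using t by (simp add: dist_norm divide_inverse mult.commute
          flip: scaleR_right_diff_distrib)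
  qed (use t in \<open>auto simp: complete_UNIV\<close>)
  then obtain z where "S z /\<^sub>R (1 + t) = z" by blast
  then have "(1 + t) *\<^sub>R (S z /\<^sub>R (1 + t)) = (1 + t) *\<^sub>R z" by simp
  then have Sz: "S z = (1 + t) *\<^sub>R z"
    using t by simp
  then have res: "residual S z = t *\<^sub>R z"
    by (simp add: residual_def algebra_simps)
  have "(1 + t) * norm z = norm (S z)"
    using Sz t by simp
  also have "\<dots> \<le> norm (S z - S 0) + norm (S 0)"
    using norm_triangle_ineq[of "S z - S 0" "S 0"] by simp
  also have "norm (S z - S 0) \<le> norm (z - 0)"
    using S unfolding nonexpansive_def by blast
  finally have "t * norm z \<le> norm (S 0)"
    by (simp add: algebra_simps)
  with res t show ?thesis by auto
qed

text \<open>
  The vector \<open>d\<close> is the element of least norm in the closure of the set of residuals, and the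
  inequality is the variational characterisation of the projection of 0 onto that set. Both come
  directly out of the regularised points, without first showing that the closure is convex.
\<close>

lemma residual_half_space:
  fixes S :: "real ^ 'n \<Rightarrow> real ^ 'n"
  assumes S: "nonexpansive S"
  shows "\<exists>d. norm d = (INF z. norm (residual S z)) \<and>
    (\<forall>y. (norm d)\<^sup>2 \<le> inner (residual S y) d)"
proof -
  define t where "t n = inverse (real (Suc n))" for n
  have tpos: "t n > 0" for n by (simp add: t_def)
  have t0: "t \<longlonglongrightarrow> 0"
    unfolding t_def by (rule LIMSEQ_inverse_real_of_nat)
  obtain z where z: "\<And>n. residual S (z n) = t n *\<^sub>R z n"
      "\<And>n. norm (residual S (z n)) \<le> norm (S 0)"
    using exists_residual_eq_scaleR[OF S tpos] by metis
  have "bounded (range (\<lambda>n. residual S (z n)))"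
    using z(2) by (auto simp: bounded_iff)
  then obtain d s where s: "strict_mono s" and "((\<lambda>n. residual S (z n)) \<circ> s) \<longlonglongrightarrow> d"
    using bounded_imp_convergent_subsequence by blast
  then have lim: "(\<lambda>n. residual S (z (s n))) \<longlonglongrightarrow> d"
    by (simp add: o_def)
  have ts: "(\<lambda>n. t (s n)) \<longlonglongrightarrow> 0"
    using LIMSEQ_subseq_LIMSEQ[OF t0 s] by (simp add: o_def)
  have half_space: "(norm d)\<^sup>2 \<le> inner (residual S y) d" for y
  proof -
    have "inner (residual S (z n) - residual S y) (residual S (z n) - t n *\<^sub>R y) \<le> 0" for n
    proof -
      \<comment> \<open>Multiplying the second factor \<open>z n - y\<close> by \<open>t n\<close> turns the possibly unbounded \<open>z n\<close> into its
        bounded residual.\<close>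
      have "residual S (z n) - t n *\<^sub>R y = t n *\<^sub>R (z n - y)"
        by (simp add: z(1) scaleR_right_diff_distrib)
      then show ?thesis
        using inner_residual_diff_nonpos[OF S, of "z n" y] tpos[of n]
        by (simp add: mult_le_0_iff)
    qed
    moreover have "(\<lambda>n. inner (residual S (z (s n)) - residual S y)
        (residual S (z (s n)) - t (s n) *\<^sub>R y)) \<longlonglongrightarrow> inner (d - residual S y) (d - 0 *\<^sub>R y)"
      by (intro tendsto_intros lim ts)
    ultimately have "inner (d - residual S y) (d - 0 *\<^sub>R y) \<le> 0"
      by (intro LIMSEQ_le_const2) auto
    then show ?thesis
      by (simp add: power2_norm_eq_inner inner_diff_left)
  qed
  have le: "norm d \<le> norm (residual S y)" for y
  proof (cases "d = 0")
    case False
    have "norm d * norm d \<le> norm (residual S y) * norm d"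
      using half_space[of y] norm_cauchy_schwarz[of "residual S y" d]
      by (simp add: power2_eq_square)
    with False show ?thesis by simp
  qed simp
  have "bdd_below (range (\<lambda>y. norm (residual S y)))"
    by (rule bdd_belowI[of _ 0]) auto
  then have "(INF y. norm (residual S y)) \<le> norm (residual S (z (s n)))" for n
    by (rule cINF_lower) simp
  then have "(INF y. norm (residual S y)) \<le> norm d"
    using tendsto_norm[OF lim] by (intro LIMSEQ_le_const) auto
  moreover have "norm d \<le> (INF y. norm (residual S y))"
    by (rule cINF_greatest) (use le in auto)
  ultimately show ?thesis using half_space by (auto intro!: exI[of _ d])
qed

section \<open>Orbits of the averaged map\<close>

lemma norm_residual_averaged_le:
  fixes S :: "real ^ 'n \<Rightarrow> real ^ 'n"
  assumes S: "nonexpansive S" and a: "0 \<le> a" "a \<le> 1"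
  shows "norm (residual S (z + a *\<^sub>R residual S z)) \<le> norm (residual S z)"
proof -
  let ?r = "residual S z"
  have "residual S (z + a *\<^sub>R ?r) = (S (z + a *\<^sub>R ?r) - S z) + (1 - a) *\<^sub>R ?r"
    by (simp add: residual_def algebra_simps)
  also have "norm \<dots> \<le> norm (S (z + a *\<^sub>R ?r) - S z) + norm ((1 - a) *\<^sub>R ?r)"
    by (rule norm_triangle_ineq)
  also have "norm (S (z + a *\<^sub>R ?r) - S z) \<le> norm ((z + a *\<^sub>R ?r) - z)"
    using S unfolding nonexpansive_def by blast
  also have "norm ((z + a *\<^sub>R ?r) - z) + norm ((1 - a) *\<^sub>R ?r) = norm ?r"
    using a by (simp add: left_diff_distrib)
  finally show ?thesis by simp
qed

text \<open>
  This follows from the identity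
  \<open>\<parallel>(1 - a)p + a q\<parallel>\<^sup>2 = (1 - a) \<parallel>p\<parallel>\<^sup>2 + a \<parallel>q\<parallel>\<^sup>2 - a (1 - a) \<parallel>q - p\<parallel>\<^sup>2\<close> for \<open>p = u - v\<close> and
  \<open>q = S u - S v\<close>, whose difference \<open>q - p\<close> is the difference of the residuals.
\<close>

lemma averaged_step_distance_decrease:
  fixes S :: "real ^ 'n \<Rightarrow> real ^ 'n"
  assumes S: "nonexpansive S" and a: "0 \<le> a"
  shows "(norm ((u + a *\<^sub>R residual S u) - (v + a *\<^sub>R residual S v)))\<^sup>2
    \<le> (norm (u - v))\<^sup>2 - a * (1 - a) * (norm (residual S u - residual S v))\<^sup>2"
proof -
  define p q where "p = u - v" and "q = S u - S v"
  have "norm q \<le> norm p"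
    using S by (simp add: p_def q_def nonexpansive_def)
  then have "inner q q \<le> inner p p"
    by (simp add: norm_le)
  then have "a * inner q q \<le> a * inner p p"
    using a by (rule mult_left_mono)
  then have "(norm (p + a *\<^sub>R (q - p)))\<^sup>2 \<le> (norm p)\<^sup>2 - a * (1 - a) * (norm (q - p))\<^sup>2"
    by (simp add: power2_norm_eq_inner inner_commute[of q p] algebra_simps)
  moreover have "(u + a *\<^sub>R residual S u) - (v + a *\<^sub>R residual S v) = p + a *\<^sub>R (q - p)"
    "residual S u - residual S v = q - p" "u - v = p"
    by (simp_all add: p_def q_def residual_def algebra_simps)
  ultimately show ?thesis by (simp only:)
qed

lemma averaged_orbits_residual_diff_tendsto_0:
  fixes S :: "real ^ 'n \<Rightarrow> real ^ 'n"
  assumes S: "nonexpansive S" and a: "0 < a" "a < 1"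
    and u: "\<And>k. u (Suc k) = u k + a *\<^sub>R residual S (u k)"
    and v: "\<And>k. v (Suc k) = v k + a *\<^sub>R residual S (v k)"
  shows "(\<lambda>k. norm (residual S (u k) - residual S (v k))) \<longlonglongrightarrow> 0"
proof -
  define D where "D k = (norm (u k - v k))\<^sup>2" for k
  define E where "E k = (norm (residual S (u k) - residual S (v k)))\<^sup>2" for k
  have step: "a * (1 - a) * E k \<le> D k - D (Suc k)" for k
    using averaged_step_distance_decrease[OF S, of a "u k" "v k"] a
    by (simp add: D_def E_def u v)
  have "decseq D"
  proof (rule decseq_SucI)
    show "D (Suc k) \<le> D k" for k
    proof -
      have "0 \<le> a * (1 - a) * E k" using a by (simp add: E_def)
      then show ?thesis using step[of k] by linarith
    qed
  qed
  then obtain L where L: "D \<longlonglongrightarrow> L"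
    by (rule decseq_convergent[of D 0]) (auto simp: D_def)
  have "(\<lambda>k. (D k - D (Suc k)) / (a * (1 - a))) \<longlonglongrightarrow> (L - L) / (a * (1 - a))"
    using a by (intro tendsto_intros L LIMSEQ_Suc) auto
  then have "(\<lambda>k. (D k - D (Suc k)) / (a * (1 - a))) \<longlonglongrightarrow> 0" by simp
  moreover have "norm (E k) \<le> (D k - D (Suc k)) / (a * (1 - a))" for k
    using step[of k] a by (simp add: E_def field_simps)
  ultimately have "E \<longlonglongrightarrow> 0"
    by (rule Lim_null_comparison[OF always_eventually[OF allI], rotated])
  then have "(\<lambda>k. sqrt (E k)) \<longlonglongrightarrow> sqrt 0" by (rule tendsto_real_sqrt)
  then show ?thesis by (simp add: E_def)
qed

lemma averaged_orbit_residual_norm_tendsto: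
  fixes S :: "real ^ 'n \<Rightarrow> real ^ 'n"
  assumes S: "nonexpansive S" and a: "0 < a" "a < 1"
    and u: "\<And>k. u (Suc k) = u k + a *\<^sub>R residual S (u k)"
  shows "(\<lambda>k. norm (residual S (u k))) \<longlonglongrightarrow> (INF z. norm (residual S z))"
proof (rule order_tendstoI)
  let ?c = "INF z. norm (residual S z)"
  have bdd: "bdd_below (range (\<lambda>y. norm (residual S y)))"
    by (rule bdd_belowI[of _ 0]) auto
  show "\<forall>\<^sub>F k in sequentially. l < norm (residual S (u k))" if "l < ?c" for l
  proof (rule always_eventually, rule allI)
    fix k
    have "?c \<le> norm (residual S (u k))" using bdd by (rule cINF_lower) simp
    with that show "l < norm (residual S (u k))" by linarith
  qed
  show "\<forall>\<^sub>F k in sequentially. norm (residual S (u k)) < b" if "?c < b" for b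
  proof -
    obtain y where y: "norm (residual S y) < b"
      using \<open>?c < b\<close> cINF_less_iff[OF _ bdd] by auto
    define v where "v k = ((\<lambda>z. z + a *\<^sub>R residual S z) ^^ k) y" for k
    have v: "v (Suc k) = v k + a *\<^sub>R residual S (v k)" for k
      by (simp add: v_def)
    have vle: "norm (residual S (v k)) \<le> norm (residual S y)" for k
    proof (induction k)
      case (Suc k)
      then show ?case
        using norm_residual_averaged_le[OF S, of a "v k"] a by (simp add: v)
    qed (simp add: v_def)
    have "\<forall>\<^sub>F k in sequentially.
        norm (residual S (u k) - residual S (v k)) < b - norm (residual S y)"
      using averaged_orbits_residual_diff_tendsto_0[of S a u v, OF S a u v] y
      by (intro order_tendstoD(2)) auto
    then show ?thesis
    proof eventually_elim
      case (elim k)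
      then show ?case
        using vle[of k] norm_triangle_sub[of "residual S (u k)" "residual S (v k)"] by linarith
    qed
  qed
qed

theorem averaged_orbit_residual_tendsto:
  fixes S :: "real ^ 'n \<Rightarrow> real ^ 'n"
  assumes S: "nonexpansive S" and a: "0 < a" "a < 1"
    and u: "\<And>k. u (Suc k) = u k + a *\<^sub>R residual S (u k)"
  shows "\<exists>d. norm d = (INF z. norm (residual S z)) \<and> (\<lambda>k. residual S (u k)) \<longlonglongrightarrow> d"
proof -
  obtain d where d: "norm d = (INF z. norm (residual S z))"
    and half_space: "\<And>y. (norm d)\<^sup>2 \<le> inner (residual S y) d"
    using residual_half_space[OF S] by blast
  have "(\<lambda>k. (norm (residual S (u k)))\<^sup>2 - (norm d)\<^sup>2) \<longlonglongrightarrow> (norm d)\<^sup>2 - (norm d)\<^sup>2"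
    unfolding d by (intro tendsto_intros averaged_orbit_residual_norm_tendsto[of S a u, OF S a u])
  then have "(\<lambda>k. (norm (residual S (u k)))\<^sup>2 - (norm d)\<^sup>2) \<longlonglongrightarrow> 0" by simp
  moreover have "norm ((norm (residual S (u k) - d))\<^sup>2) \<le> (norm (residual S (u k)))\<^sup>2 - (norm d)\<^sup>2"
    for k
    using half_space[of "u k"]
    unfolding real_norm_def abs_of_nonneg[OF zero_le_power2]
    by (simp add: power2_norm_eq_inner inner_diff_left inner_diff_right inner_commute)
  ultimately have "(\<lambda>k. (norm (residual S (u k) - d))\<^sup>2) \<longlonglongrightarrow> 0"
    by (rule Lim_null_comparison[OF always_eventually[OF allI], rotated])
  then have "(\<lambda>k. sqrt ((norm (residual S (u k) - d))\<^sup>2)) \<longlonglongrightarrow> sqrt 0"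
    by (rule tendsto_real_sqrt)
  then have "(\<lambda>k. residual S (u k)) \<longlonglongrightarrow> d"
    by (simp add: tendsto_norm_zero_iff LIM_zero_iff)
  with d show ?thesis by blast
qed

section \<open>The line search iteration\<close>

text \<open>
  The norms are decreasing and bounded below, so they converge to some \<open>L \<ge> c > 0\<close>; a reduction by
  the factor \<open>1 - \<epsilon>\<close> is impossible once the norm is close enough to \<open>L\<close>.
\<close>

lemma line_search_eventually_nominal:
  fixes S :: "real ^ 'n \<Rightarrow> real ^ 'n"
  assumes S: "nonexpansive S" and c: "c > 0" "\<And>z. c \<le> norm (residual S z)"
    and a: "0 \<le> \<alpha>bar" "\<alpha>bar \<le> 1" and \<epsilon>: "0 < \<epsilon>" "\<epsilon> \<le> 1"
    and iter: "line_search_iteration S \<alpha>bar \<epsilon> \<alpha>max x \<alpha>"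
  shows "\<forall>\<^sub>F k in sequentially. \<alpha> k = \<alpha>bar"
proof -
  define R where "R k = norm (residual S (x k))" for k
  have x: "x (Suc k) = x k + \<alpha> k *\<^sub>R residual S (x k)" for k
    using iter by (auto simp: line_search_iteration_def Let_def)
  have shrink: "R (Suc k) \<le> (1 - \<epsilon>) * R k" if "\<alpha> k \<noteq> \<alpha>bar" for k
  proof -
    let ?xbar = "x k + \<alpha>bar *\<^sub>R residual S (x k)"
    have "R (Suc k) \<le> (1 - \<epsilon>) * norm (residual S ?xbar)"
      using iter that unfolding line_search_iteration_def Let_def R_def by blast
    also have "\<dots> \<le> (1 - \<epsilon>) * R k"
      unfolding R_def using \<epsilon> by (intro mult_left_mono norm_residual_averaged_le[OF S a]) auto
    finally show ?thesis .
  qed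
  have "decseq R"
  proof (rule decseq_SucI)
    show "R (Suc k) \<le> R k" for k
    proof (cases "\<alpha> k = \<alpha>bar")
      case True
      then show ?thesis
        using norm_residual_averaged_le[OF S a, of "x k"] by (simp add: R_def x)
    next
      case False
      have "0 \<le> \<epsilon> * R k" using \<epsilon> by (simp add: R_def)
      with shrink[OF False] show ?thesis by (simp add: algebra_simps)
    qed
  qed
  then obtain L where L: "R \<longlonglongrightarrow> L" and LR: "\<And>k. L \<le> R k"
    by (rule decseq_convergent[of R 0]) (auto simp: R_def)
  have "c \<le> L"
    using L by (rule LIMSEQ_le_const) (use c in \<open>auto simp: R_def\<close>)
  then have "(1 - \<epsilon>) * L < L"
    using c \<epsilon> by (simp add: algebra_simps)
  moreover have "(\<lambda>k. (1 - \<epsilon>) * R k) \<longlonglongrightarrow> (1 - \<epsilon>) * L"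
    by (intro tendsto_intros L)
  ultimately have "\<forall>\<^sub>F k in sequentially. (1 - \<epsilon>) * R k < L"
    by (intro order_tendstoD(2))
  then show ?thesis
  proof eventually_elim
    case (elim k)
    then show ?case using shrink[of k] LR[of "Suc k"] by force
  qed
qed

theorem theorem3:
  fixes S :: "real ^ 'n \<Rightarrow> real ^ 'n" and c \<alpha>bar \<epsilon> \<alpha>max :: real
    and x :: "nat \<Rightarrow> real ^ 'n" and \<alpha> :: "nat \<Rightarrow> real"
  assumes "nonexpansive S"
    and "fixed_points S = {}"
    and "(INF z. norm (S z - z)) = c" and "c > 0"
    and "0 < \<alpha>bar" and "\<alpha>bar < 1"
    and "0 < \<epsilon>" and "\<epsilon> < 1"
    and "\<alpha>bar \<le> \<alpha>max"
    and "line_search_iteration S \<alpha>bar \<epsilon> \<alpha>max x \<alpha>"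
  shows "\<exists>d. norm d = c \<and>
    (\<lambda>k. residual S (x k)) \<longlonglongrightarrow> d \<and>
    (\<lambda>k. x (Suc k) - x k) \<longlonglongrightarrow> \<alpha>bar *\<^sub>R d"
proof -
  have c: "(INF z. norm (residual S z)) = c"
    using assms(3) by (simp add: residual_def)
  have "bdd_below (range (\<lambda>z. norm (residual S z)))"
    by (rule bdd_belowI[of _ 0]) auto
  then have cle: "c \<le> norm (residual S z)" for z
    unfolding c[symmetric] by (rule cINF_lower) simp
  have x: "x (Suc k) = x k + \<alpha> k *\<^sub>R residual S (x k)" for k
    using assms(10) by (auto simp: line_search_iteration_def Let_def)
  have "\<forall>\<^sub>F k in sequentially. \<alpha> k = \<alpha>bar"
    by (rule line_search_eventually_nominal[OF assms(1,4) cle _ _ assms(7) _ assms(10)])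
      (use assms in auto)
  then obtain N where N: "\<And>k. k \<ge> N \<Longrightarrow> \<alpha> k = \<alpha>bar"
    by (auto simp: eventually_sequentially)
  have "x (Suc k + N) = x (k + N) + \<alpha>bar *\<^sub>R residual S (x (k + N))" for k
    using x[of "k + N"] N[of "k + N"] by simp
  then obtain d where d: "norm d = c" "(\<lambda>k. residual S (x (k + N))) \<longlonglongrightarrow> d"
    using averaged_orbit_residual_tendsto[OF assms(1,5,6), of "\<lambda>k. x (k + N)"]
    unfolding c by blast
  from d(2) have lim: "(\<lambda>k. residual S (x k)) \<longlonglongrightarrow> d"
    by (rule LIMSEQ_offset)
  have "(\<lambda>k. \<alpha>bar *\<^sub>R residual S (x k)) \<longlonglongrightarrow> \<alpha>bar *\<^sub>R d"
    by (intro tendsto_intros lim)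
  moreover have "\<forall>\<^sub>F k in sequentially. \<alpha>bar *\<^sub>R residual S (x k) = x (Suc k) - x k"
    using N x by (auto simp: eventually_sequentially intro!: exI[of _ N])
  ultimately have "(\<lambda>k. x (Suc k) - x k) \<longlonglongrightarrow> \<alpha>bar *\<^sub>R d"
    by (rule Lim_transform_eventually)
  with d(1) lim show ?thesis by blast
qed

end
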